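(* Let $(X,d)$ be a compact metric space. If $(X,d)$ is almost convex, then $(X,d)$ is totally convex.
   Context: A metric space $(X,d)$ is almost convex if, for all $x,y \in X$, all positive real numbers $r,s$ with $r+s = d(x,y)$, and every $\varepsilon > 0$, there is a point $z \in X$ such that $d(x,z) \leq s + \varepsilon$ and $d(y,z) \leq r + \varepsilon$. A metric space $(X,d)$ is totally convex if, for all $x,y \in X$ and all positive real numbers $r,s$ with $r+s = d(x,y)$, there is a point $z \in X$ such that $d(x,z) = s$ and $d(y,z) = r$. *)

theory Defs
  imports "HOL-Analysis.Analysis"
begin

context Metric_space
begin

definition almost_convex :: bool where
  "almost_convex \<longleftrightarrow>
    (\<forall>x\<in>M. \<forall>y\<in>M. \<forall>r>0. \<forall>s>0. r + s = d x y \<longrightarrow>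
      (\<forall>\<epsilon>>0. \<exists>z\<in>M. d x z \<le> s + \<epsilon> \<and> d y z \<le> r + \<epsilon>))"

definition totally_convex :: bool where
  "totally_convex \<longleftrightarrow>
    (\<forall>x\<in>M. \<forall>y\<in>M. \<forall>r>0. \<forall>s>0. r + s = d x y \<longrightarrow>
      (\<exists>z\<in>M. d x z = s \<and> d y z = r))"

end

end

theory Submission
  imports Defs
begin

text \<open>A limit point \<open>z\<close> of approximate division points satisfies \<open>d x z \<le> s\<close> and \<open>d y z \<le> r\<close>;
  since \<open>r + s = d x y\<close>, the triangle inequality forces equality in both.\<close>

theorem theorem3p1:
  fixes X :: "'a set" and d :: "'a \<Rightarrow> 'a \<Rightarrow> real"
  assumes "Metric_space X d"
    and "compact_space (Metric_space.mtopology X d)"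
    and "Metric_space.almost_convex X d"
  shows "Metric_space.totally_convex X d"
proof -
  interpret Metric_space X d by fact
  show ?thesis
    unfolding totally_convex_def
  proof (intro ballI allI impI)
    fix x y r s
    assume x: "x \<in> X" and y: "y \<in> X" and "r > 0" "s > 0" and rs: "r + s = d x y"
    \<comment> \<open>Almost convexity with the tolerance \<open>inverse (real (Suc n))\<close>:
      positive already at \<open>n = 0\<close>, and tending to \<open>0\<close>, so that the error
      disappears in the limit.\<close>
    have "\<exists>z\<in>X. d x z \<le> s + inverse (real (Suc n)) \<and> d y z \<le> r + inverse (real (Suc n))" for n
      using assms(3) x y \<open>r > 0\<close> \<open>s > 0\<close> rs unfolding almost_convex_def
      by (meson inverse_positive_iff_positive of_nat_0_less_iff zero_less_Suc)
    then obtain f where fX: "\<And>n. f n \<in> X"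
      and fx: "\<And>n. d x (f n) \<le> s + inverse (real (Suc n))"
      and fy: "\<And>n. d y (f n) \<le> r + inverse (real (Suc n))"
      by metis
    obtain z and \<sigma> :: "nat \<Rightarrow> nat" where z: "z \<in> X" and \<sigma>: "strict_mono \<sigma>"
      and lim: "limitin mtopology (f \<circ> \<sigma>) z sequentially"
      using assms(2) fX unfolding compact_space_sequentially by blast
    have d0: "(\<lambda>n. d (f (\<sigma> n)) z) \<longlonglongrightarrow> 0"
      using lim by (simp add: limitin_metric_dist_null o_def)
    have i0: "(\<lambda>n. inverse (real (Suc (\<sigma> n)))) \<longlonglongrightarrow> 0"
      using LIMSEQ_subseq_LIMSEQ[OF LIMSEQ_inverse_real_of_nat \<sigma>] by (simp add: o_def)
    \<comment> \<open>Kept general in \<open>u\<close> and \<open>t\<close> because it is used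
      twice: for \<open>x\<close> with \<open>s\<close> and for \<open>y\<close> with
      \<open>r\<close>.\<close>
    have lim_le: "d u z \<le> t"
      if "u \<in> X" "\<And>n. d u (f n) \<le> t + inverse (real (Suc n))" for u t
    \<comment> \<open>The constant \<open>d u z\<close> lies below a sequence with limit
      \<open>t\<close>. Its terms come from the triangle inequality through
      \<open>f (\<sigma> n)\<close>: the bound on \<open>d u (f (\<sigma> n))\<close> plus the
      vanishing distance from \<open>f (\<sigma> n)\<close> to \<open>z\<close>.\<close>
    proof (rule LIMSEQ_le_const)
      show "(\<lambda>n. t + inverse (real (Suc (\<sigma> n))) + d (f (\<sigma> n)) z) \<longlonglongrightarrow> t"
        using tendsto_add[OF tendsto_add[OF tendsto_const i0] d0] by simp
      have "d u z \<le> t + inverse (real (Suc (\<sigma> n))) + d (f (\<sigma> n)) z" for n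
        using triangle[OF that(1) fX z, of "\<sigma> n"] that(2)[of "\<sigma> n"] by linarith
      then show "\<exists>N. \<forall>n\<ge>N. d u z \<le> t + inverse (real (Suc (\<sigma> n))) + d (f (\<sigma> n)) z"
        by blast
    qed
    have "d x z \<le> s" "d y z \<le> r" "d x y \<le> d x z + d y z"
      using lim_le[OF x fx] lim_le[OF y fy] triangle[OF x z y] commute[of z y] by simp_all
    with rs z show "\<exists>z\<in>X. d x z = s \<and> d y z = r"
      by (intro bexI[of _ z]) auto
  qed
qed

end
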